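(* Suppose that Assumption A (see context) holds. Let $\gamma_k>0$ and $\eta_k,\mu_k,\nu_k\ge 0$ for all $k\ge 0$, and let $\{\bm{x}^{k}\}$ and $\{\widetilde{\bm{x}}^{k}\}$ be sequences generated by the inexact Bregman proximal point algorithm (iBPPA, see context) with these parameters. Set $\sigma_{-1}:=0$, $\mu_{-1}:=0$, $\sigma_k:=\sum_{i=0}^{k}\gamma_i^{-1}$ and $\xi_k:=f(\widetilde{\bm{x}}^{k+1})-f(\widetilde{\bm{x}}^{k})$ for every integer $k\ge 0$. Then $\xi_k\le \gamma_k(\mu_{k-1}+\mu_k)+\rho\eta_k+\nu_k$ for every $k\ge 0$, and for any optimal solution $\bm{x}^*$ of the problem $\min\{f(\bm{x}):\bm{x}\in\overline{\mathcal{C}}\}$ and every integer $N\ge 1$, $$f(\widetilde{\bm{x}}^{N})-f(\bm{x}^* )\le \sigma_{N-1}^{-1}\left(\mathcal{D}_{\phi}(\bm{x}^*,\bm{x}^{0})+\sum_{k=0}^{N-1}\mu_k+\sum_{k=0}^{N-1}\gamma_k^{-1}(\rho\eta_k+\nu_k)+\sum_{k=0}^{N-1}\sigma_{k-1}\xi_k\right).$$ Moreover, if $\sum_{k}\mu_k<\infty$, $\sum_k\gamma_k^{-1}\nu_k<\infty$, $\sum_k\gamma_k^{-1}\eta_k<\infty$ and $\sum_k\sigma_{k-1}\xi_k<\infty$ (the last in the sense that its partial sums are bounded above), then $$f(\widetilde{\bm{x}}^{N})-f(\bm{x}^* )\le O\left(\frac{1}{\sum_{k=0}^{N-1}\gamma_k^{-1}}\right),$$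 i.e. there is a constant $M$ independent of $N$ such that $f(\widetilde{\bm{x}}^{N})-f(\bm{x}^* )\le M\big(\sum_{k=0}^{N-1}\gamma_k^{-1}\big)^{-1}$ for all $N\ge 1$.
   Context: $\mathbb{E}$ is a real finite-dimensional Euclidean space with inner product $\langle\cdot,\cdot\rangle$ and induced norm $\|\cdot\|$; $f:\mathbb{E}\to(-\infty,\infty]$ is a proper closed convex function; $\mathcal{C}\subseteq\mathbb{E}$ is a nonempty convex open set with closure $\overline{\mathcal{C}}$. The problem is $\min\{f(\bm{x}):\bm{x}\in\overline{\mathcal{C}}\}$. For $\nu\ge0$ and $\bm{x}\in\mathrm{dom}\,f$, the $\nu$-subdifferential is $\partial_\nu f(\bm{x}):=\{\bm{d}: f(\bm{y})\ge f(\bm{x})+\langle \bm{d},\bm{y}-\bm{x}\rangle-\nu\ \ \forall \bm{y}\in\mathbb{E}\}$. A proper closed convex function $\phi$ is essentially smooth if $\mathrm{int}\,\mathrm{dom}\,\phi\neq\emptyset$, $\phi$ is differentiable on $\mathrm{int}\,\mathrm{dom}\,\phi$, and $\|\nabla\phi(\bm{x}_k)\|\to\infty$ for every sequence in $\mathrm{int}\,\mathrm{dom}\,\phi$ converging to a boundary point of $\mathrm{int}\,\mathrm{dom}\,\phi$. The Bregman distance is $\mathcal{D}_\phi(\bm{x},\bm{y}):=\phi(\bm{x})-\phi(\bm{y})-\langle\nabla\phi(\bm{y}),\bm{x}-\bm{y}\rangle$ (for $\phi$ finite at $\bm{x},\bm{y}$ and differentiable at $\bm{y}$). Bregman function with zone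 $\mathcal{S}$ ($\mathcal{S}$ nonempty open convex): $\phi:\overline{\mathcal{S}}\to\mathbb{R}$ such that (B1) $\phi$ is strictly convex and continuous on $\overline{\mathcal{S}}$; (B2) $\phi$ is continuously differentiable on $\mathcal{S}$; (B3) $\{\bm{x}\in\overline{\mathcal{S}}:\mathcal{D}_\phi(\bm{x},\bm{y})\le\alpha\}$ is bounded for every $\bm{y}\in\mathcal{S},\alpha\in\mathbb{R}$, and $\{\bm{y}\in\mathcal{S}:\mathcal{D}_\phi(\bm{x},\bm{y})\le\alpha\}$ is bounded for every $\bm{x}\in\overline{\mathcal{S}},\alpha\in\mathbb{R}$; (B4) if $\{\bm{y}^k\}\subseteq\mathcal{S}$ converges to $\bm{y}^*\in\overline{\mathcal{S}}$, then $\mathcal{D}_\phi(\bm{y}^*,\bm{y}^k)\to0$; (B5) if $\{\bm{x}^k\}\subseteq\overline{\mathcal{S}}$ is bounded, $\{\bm{y}^k\}\subseteq\mathcal{S}$, $\bm{y}^k\to\bm{y}^*$ and $\mathcal{D}_\phi(\bm{x}^k,\bm{y}^k)\to0$, then $\bm{x}^k\to\bm{y}^*$. Assumption A: (i) $\mathrm{dom}\,f\cap\mathcal{C}\ne\emptyset$; (ii) $\rho:=\sup\{\|\bm{x}-\bm{y}\|:\bm{x},\bm{y}\in\mathrm{dom}\,f\cap\overline{\mathcal{C}}\}<\infty$; (iii) $\phi:\mathbb{E}\to(-\infty,\infty]$ is proper closed convex with $\mathrm{dom}\,\phi=\overline{\mathcal{C}}$, $\phi$ is a Bregman function with zone $\mathcal{C}$,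 and $\phi$ is essentially smooth. iBPPA: choose $\bm{x}^0=\widetilde{\bm{x}}^0\in\mathcal{C}$ arbitrarily. For $k=0,1,2,\dots$, find a pair $(\bm{x}^{k+1},\widetilde{\bm{x}}^{k+1})$ (by approximately solving $\min_{\bm{x}} f(\bm{x})+\gamma_k\mathcal{D}_\phi(\bm{x},\bm{x}^k)$) such that $\bm{x}^{k+1}\in\mathcal{C}$, $\widetilde{\bm{x}}^{k+1}\in\mathrm{dom}\,f\cap\overline{\mathcal{C}}$ and, for some $\Delta^k\in\mathbb{E}$, $$\Delta^k\in\partial_{\nu_k}f(\widetilde{\bm{x}}^{k+1})+\gamma_k\big(\nabla\phi(\bm{x}^{k+1})-\nabla\phi(\bm{x}^k)\big),\quad \|\Delta^k\|\le\eta_k,\quad \mathcal{D}_\phi(\widetilde{\bm{x}}^{k+1},\bm{x}^{k+1})\le\mu_k.$$ Convention: the term $\sigma_{-1}\xi_0$ equals $0$ (even if $f(\widetilde{\bm{x}}^0)=+\infty$, in which case $\xi_0=-\infty$). *)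

theory Defs
  imports "HOL-Analysis.Analysis"
begin

definition edom :: "('a \<Rightarrow> ereal) \<Rightarrow> 'a set" where
  "edom f = {x. f x < \<infinity>}"

(* Epigraph of an extended-real-valued function; the library's epigraph is for real-valued ones. *)
definition eepigraph :: "('a \<Rightarrow> ereal) \<Rightarrow> ('a \<times> real) set" where
  "eepigraph f = {(x, r). f x \<le> ereal r}"

definition proper_closed_convex :: "('a::euclidean_space \<Rightarrow> ereal) \<Rightarrow> bool" where
  "proper_closed_convex f \<longleftrightarrow>
     (\<forall>x. f x \<noteq> -\<infinity>) \<and> edom f \<noteq> {} \<and> closed (eepigraph f) \<and> convex (eepigraph f)"

definition eps_subdiff :: "real \<Rightarrow> ('a::euclidean_space \<Rightarrow> ereal) \<Rightarrow> 'a \<Rightarrow> 'a set" where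
  "eps_subdiff \<nu> f x = {d. x \<in> edom f \<and> (\<forall>y. f y \<ge> f x + ereal (d \<bullet> (y - x)) - ereal \<nu>)}"

(* Meaningful only at points where g is differentiable. *)
definition grad :: "('a::euclidean_space \<Rightarrow> real) \<Rightarrow> 'a \<Rightarrow> 'a" where
  "grad g x = (THE D. GDERIV g x :> D)"

definition bregman_dist :: "('a::euclidean_space \<Rightarrow> real) \<Rightarrow> 'a \<Rightarrow> 'a \<Rightarrow> real" where
  "bregman_dist g x y = g x - g y - grad g y \<bullet> (x - y)"

definition strictly_convex_on :: "'a::real_vector set \<Rightarrow> ('a \<Rightarrow> real) \<Rightarrow> bool" where
  "strictly_convex_on S g \<longleftrightarrow> convex S \<and>
     (\<forall>x\<in>S. \<forall>y\<in>S. \<forall>t. x \<noteq> y \<and> 0 < t \<and> t < 1 \<longrightarrow>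
        g ((1 - t) *\<^sub>R x + t *\<^sub>R y) < (1 - t) * g x + t * g y)"

(* Only the values of g on the closure of S matter: S is open, so gradients at points of S
   do not depend on values elsewhere. *)
definition bregman_function :: "('a::euclidean_space \<Rightarrow> real) \<Rightarrow> 'a set \<Rightarrow> bool" where
  "bregman_function g S \<longleftrightarrow>
     S \<noteq> {} \<and> open S \<and> convex S \<and>
     strictly_convex_on (closure S) g \<and> continuous_on (closure S) g \<and>
     g differentiable_on S \<and> continuous_on S (grad g) \<and>
     (\<forall>y\<in>S. \<forall>\<alpha>. bounded {x \<in> closure S. bregman_dist g x y \<le> \<alpha>}) \<and>
     (\<forall>x\<in>closure S. \<forall>\<alpha>. bounded {y \<in> S. bregman_dist g x y \<le> \<alpha>}) \<and>
     (\<forall>y l. (\<forall>k. y k \<in> S) \<and> l \<in> closure S \<and> y \<longlonglongrightarrow> l \<longrightarrow>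
        (\<lambda>k::nat. bregman_dist g l (y k)) \<longlonglongrightarrow> 0) \<and>
     (\<forall>x y l. (\<forall>k. x k \<in> closure S) \<and> bounded (range x) \<and> (\<forall>k. y k \<in> S) \<and> y \<longlonglongrightarrow> l \<and>
        (\<lambda>k::nat. bregman_dist g (x k) (y k)) \<longlonglongrightarrow> 0 \<longrightarrow> x \<longlonglongrightarrow> l)"

(* The finite values of an extended-real-valued function, as a real function (0 outside edom). *)
definition fin :: "('a \<Rightarrow> ereal) \<Rightarrow> 'a \<Rightarrow> real" where
  "fin \<phi> x = real_of_ereal (\<phi> x)"

definition essentially_smooth :: "('a::euclidean_space \<Rightarrow> ereal) \<Rightarrow> bool" where
  "essentially_smooth \<phi> \<longleftrightarrow>
     proper_closed_convex \<phi> \<and>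
     interior (edom \<phi>) \<noteq> {} \<and>
     fin \<phi> differentiable_on interior (edom \<phi>) \<and>
     (\<forall>x l. (\<forall>k. x k \<in> interior (edom \<phi>)) \<and> l \<in> frontier (interior (edom \<phi>)) \<and> x \<longlonglongrightarrow> l \<longrightarrow>
        filterlim (\<lambda>k::nat. norm (grad (fin \<phi>) (x k))) at_top sequentially)"

definition pair_dists :: "('a::euclidean_space \<Rightarrow> ereal) \<Rightarrow> 'a set \<Rightarrow> real set" where
  "pair_dists f C = {norm (x - y) | x y. x \<in> edom f \<inter> closure C \<and> y \<in> edom f \<inter> closure C}"

(* rho of the paper; a genuine supremum when pair_dists is nonempty and bounded above. *)
definition dom_diam :: "('a::euclidean_space \<Rightarrow> ereal) \<Rightarrow> 'a set \<Rightarrow> real" where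
  "dom_diam f C = Sup (pair_dists f C)"

definition assumption_A ::
    "('a::euclidean_space \<Rightarrow> ereal) \<Rightarrow> ('a \<Rightarrow> ereal) \<Rightarrow> 'a set \<Rightarrow> bool" where
  "assumption_A f \<phi> C \<longleftrightarrow>
     edom f \<inter> C \<noteq> {} \<and>
     bdd_above (pair_dists f C) \<and>
     proper_closed_convex \<phi> \<and> edom \<phi> = closure C \<and>
     bregman_function (fin \<phi>) C \<and> essentially_smooth \<phi>"

definition optimal_solution :: "('a::euclidean_space \<Rightarrow> ereal) \<Rightarrow> 'a set \<Rightarrow> 'a \<Rightarrow> bool" where
  "optimal_solution f C x \<longleftrightarrow> x \<in> closure C \<and> (\<forall>y\<in>closure C. f x \<le> f y)"

definition iBPPA ::
    "('a::euclidean_space \<Rightarrow> ereal) \<Rightarrow> ('a \<Rightarrow> ereal) \<Rightarrow> 'a set \<Rightarrow>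
     (nat \<Rightarrow> real) \<Rightarrow> (nat \<Rightarrow> real) \<Rightarrow> (nat \<Rightarrow> real) \<Rightarrow> (nat \<Rightarrow> real) \<Rightarrow>
     (nat \<Rightarrow> 'a) \<Rightarrow> (nat \<Rightarrow> 'a) \<Rightarrow> bool" where
  "iBPPA f \<phi> C \<gamma> \<eta> \<mu> \<nu> x xt \<longleftrightarrow>
     x 0 = xt 0 \<and> x 0 \<in> C \<and>
     (\<forall>k. x (Suc k) \<in> C \<and> xt (Suc k) \<in> edom f \<inter> closure C \<and>
        (\<exists>\<Delta>. \<Delta> \<in> {d + \<gamma> k *\<^sub>R (grad (fin \<phi>) (x (Suc k)) - grad (fin \<phi>) (x k)) | d.
                       d \<in> eps_subdiff (\<nu> k) f (xt (Suc k))} \<and>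
             norm \<Delta> \<le> \<eta> k \<and>
             bregman_dist (fin \<phi>) (xt (Suc k)) (x (Suc k)) \<le> \<mu> k))"

(* prev s k is s_{k-1}, with the convention s_{-1} = 0. *)
definition prev :: "(nat \<Rightarrow> real) \<Rightarrow> nat \<Rightarrow> real" where
  "prev s k = (if k = 0 then 0 else s (k - 1))"

(* sigma_k of the paper. *)
definition inv_step_sum :: "(nat \<Rightarrow> real) \<Rightarrow> nat \<Rightarrow> real" where
  "inv_step_sum \<gamma> k = (\<Sum>i\<le>k. inverse (\<gamma> i))"

(* xi f xt 0 = -\<infinity> if f (xt 0) = \<infinity>. Since 0 * (-\<infinity>) = 0 in ereal, the term
   ereal (prev (inv_step_sum \<gamma>) 0) * xi f xt 0 is 0 in every case. *)
definition xi :: "('a \<Rightarrow> ereal) \<Rightarrow> (nat \<Rightarrow> 'a) \<Rightarrow> nat \<Rightarrow> ereal" where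
  "xi f xt k = f (xt (Suc k)) - f (xt k)"

end

theory Submission
  imports Defs
begin

text \<open>
  Everything follows from one inequality.  Write $g$ for the finite part of $\phi$ and $D$ for its
  Bregman distance.  The approximate optimality condition says that
  $\Delta^k - \gamma_k(\nabla g(x^{k+1}) - \nabla g(x^k))$ is a $\nu_k$-subgradient of $f$ at
  $p = \tilde x^{k+1}$; testing it at a point $u \in \mathrm{dom} f \cap \overline{C}$ and bounding
  $\langle \Delta^k, p - u\rangle$ by $\rho\eta_k$ leaves the inner product of the gradient
  difference with $u - p$, which the four-point identity turns into Bregman distances:
  \[ f(p) \le f(u) + \rho\eta_k + \nu_k
       + \gamma_k\,(D(u,x^k) - D(u,x^{k+1}) - D(p,x^k) + D(p,x^{k+1})). \]
  Here $D(p,x^{k+1}) \le \mu_k$, and $D(p,x^k) \ge 0$ because $g$ lies above its tangents.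

  With $u = \tilde x^k$ one has moreover $D(u,x^k) \le \mu_{k-1}$ and $D(u,x^{k+1}) \ge 0$, which
  is the bound on $\xi_k$.  With $u = x^*$ the terms $D(x^*,x^k) - D(x^*,x^{k+1})$ telescope after
  division by $\gamma_k$, which bounds
  $\sum_{k<N} \gamma_k^{-1}(f(\tilde x^{k+1}) - f(x^*))$.  Since the values $f(\tilde x^k)$ need
  not decrease, passing from this weighted sum to its last term costs
  $\sum_{k<N}\sigma_{k-1}\xi_k$; this is summation by parts.
\<close>

section \<open>Gradients and Bregman distances\<close>

lemma GDERIV_grad:
  fixes g :: "'a::euclidean_space \<Rightarrow> real"
  assumes "g differentiable at y"
  shows "GDERIV g y :> grad g y"
proof -
  obtain g' where g': "(g has_derivative g') (at y)"
    using assms by (auto simp: differentiable_def)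
  then have lin: "linear g'" by (rule has_derivative_linear)
  have "g' = (\<lambda>h. h \<bullet> (\<Sum>b\<in>Basis. g' b *\<^sub>R b))"
  proof
    fix h :: 'a
    have "g' h = g' (\<Sum>b\<in>Basis. (h \<bullet> b) *\<^sub>R b)" by (simp add: euclidean_representation)
    also have "\<dots> = (\<Sum>b\<in>Basis. (h \<bullet> b) * g' b)"
      using lin by (simp add: linear_sum linear_scale)
    also have "\<dots> = h \<bullet> (\<Sum>b\<in>Basis. g' b *\<^sub>R b)"
      by (simp add: inner_sum_right mult.commute)
    finally show "g' h = h \<bullet> (\<Sum>b\<in>Basis. g' b *\<^sub>R b)" .
  qed
  with g' have ex: "GDERIV g y :> (\<Sum>b\<in>Basis. g' b *\<^sub>R b)"
    unfolding gderiv_def by metis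
  have unique: "E = F" if "GDERIV g y :> E" "GDERIV g y :> F" for E F
  proof -
    have "(\<lambda>h. h \<bullet> E) = (\<lambda>h. h \<bullet> F)"
      using that unfolding gderiv_def by (rule has_derivative_unique)
    then have "\<forall>h. h \<bullet> E = h \<bullet> F" by metis
    then show ?thesis by (simp add: vector_eq_ldot)
  qed
  show ?thesis
    unfolding grad_def using ex by (rule theI) (rule unique[OF _ ex])
qed

text \<open>
  Convexity bounds every difference quotient from \<open>y\<close> in the direction \<open>z - y\<close> by the one with step
  \<open>1\<close>; the derivative is the limit of these quotients.
\<close>
lemma convex_on_above_gradient:
  fixes g :: "'a::real_inner \<Rightarrow> real"
  assumes conv: "convex_on S g" and y: "y \<in> S" and z: "z \<in> S" and G: "GDERIV g y :> E"
  shows "E \<bullet> (z - y) \<le> g z - g y"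
proof -
  define h where "h t = g (y + t *\<^sub>R (z - y))" for t :: real
  have line: "((\<lambda>t. y + t *\<^sub>R (z - y)) has_derivative (\<lambda>t. t *\<^sub>R (z - y))) (at 0)"
    by (auto intro!: derivative_eq_intros)
  have "(h has_derivative (\<lambda>t. (t *\<^sub>R (z - y)) \<bullet> E)) (at 0)"
    unfolding h_def using has_derivative_compose[OF line, of g "\<lambda>v. v \<bullet> E"] G
    by (simp add: gderiv_def)
  moreover have "(\<lambda>t. (t *\<^sub>R (z - y)) \<bullet> E) = (*) (E \<bullet> (z - y))"
    by (simp add: fun_eq_iff inner_commute)
  ultimately have "(h has_field_derivative (E \<bullet> (z - y))) (at 0)"
    by (simp add: has_field_derivative_def)
  then have "((\<lambda>t. (h t - h 0) / t) \<longlongrightarrow> E \<bullet> (z - y)) (at 0)"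
    by (simp add: DERIV_def)
  then have lim: "((\<lambda>t. (h t - h 0) / t) \<longlongrightarrow> E \<bullet> (z - y)) (at_right 0)"
    by (rule tendsto_mono[rotated]) (simp add: at_le)
  have quotient: "(h t - h 0) / t \<le> g z - g y" if t: "0 < t" "t < 1" for t
  proof -
    have "h t = g ((1 - t) *\<^sub>R y + t *\<^sub>R z)"
      unfolding h_def by (simp add: algebra_simps)
    also have "\<dots> \<le> (1 - t) * g y + t * g z"
      using convex_onD[OF conv, of t y z] t y z by simp
    finally have "h t - h 0 \<le> (g z - g y) * t"
      by (simp add: h_def algebra_simps)
    with t show ?thesis by (simp add: pos_divide_le_eq)
  qed
  have "\<forall>\<^sub>F t in at_right 0. (h t - h 0) / t \<le> g z - g y"
    unfolding eventually_at_right_field using quotient by (metis zero_less_one)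
  with lim show ?thesis
    by (rule tendsto_upperbound) simp
qed

lemma bregman_dist_nonneg:
  assumes B: "bregman_function g S" and y: "y \<in> S" and z: "z \<in> closure S"
  shows "0 \<le> bregman_dist g z y"
proof -
  have "open S" "g differentiable_on S" and strict: "strictly_convex_on (closure S) g"
    using B by (auto simp: bregman_function_def)
  then have G: "GDERIV g y :> grad g y"
    using y by (intro GDERIV_grad) (simp add: differentiable_on_eq_differentiable_at)
  have "convex_on (closure S) g"
  proof (rule convex_onI)
    show "convex (closure S)" using strict by (simp add: strictly_convex_on_def)
    fix t :: real and a b assume ab: "0 < t" "t < 1" "a \<in> closure S" "b \<in> closure S"
    show "g ((1 - t) *\<^sub>R a + t *\<^sub>R b) \<le> (1 - t) * g a + t * g b"
    proof (cases "a = b")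
      case True
      then show ?thesis by (simp add: algebra_simps)
    next
      case False
      then show ?thesis using strict ab by (simp add: strictly_convex_on_def less_imp_le)
    qed
  qed
  then have "grad g y \<bullet> (z - y) \<le> g z - g y"
    using convex_on_above_gradient[OF _ _ z G] y closure_subset by blast
  then show ?thesis by (simp add: bregman_dist_def)
qed

text \<open>The function values cancel, and what remains is affine in \<open>u\<close> and \<open>p\<close>.\<close>
lemma bregman_dist_four_point:
  "(grad g b - grad g a) \<bullet> (u - p) =
     bregman_dist g u a - bregman_dist g u b - bregman_dist g p a + bregman_dist g p b"
  by (simp add: bregman_dist_def inner_diff_left inner_diff_right)

section \<open>The diameter of the feasible part of the domain\<close>

lemma norm_diff_le_dom_diam:
  assumes "bdd_above (pair_dists f C)"
    and "u \<in> edom f \<inter> closure C" and "p \<in> edom f \<inter> closure C"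
  shows "norm (u - p) \<le> dom_diam f C"
  unfolding dom_diam_def using assms by (intro cSup_upper) (auto simp: pair_dists_def)

lemma dom_diam_nonneg:
  assumes "bdd_above (pair_dists f C)" and "edom f \<inter> closure C \<noteq> {}"
  shows "0 \<le> dom_diam f C"
proof -
  from assms(2) obtain u where "u \<in> edom f \<inter> closure C" by blast
  with norm_diff_le_dom_diam[OF assms(1), of u u] show ?thesis by simp
qed

section \<open>One step of the algorithm\<close>

lemma ereal_real_on_edom:
  assumes "\<forall>x. f x \<noteq> -\<infinity>" and "u \<in> edom f"
  shows "f u = ereal (fin f u)"
  using assms by (cases "f u") (auto simp: edom_def fin_def)

lemma eps_subdiff_fin:
  assumes proper: "\<forall>x. f x \<noteq> -\<infinity>" and d: "d \<in> eps_subdiff \<nu> f p" and u: "u \<in> edom f"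
  shows "fin f p \<le> fin f u + d \<bullet> (p - u) + \<nu>"
proof -
  have "p \<in> edom f" and "f u \<ge> f p + ereal (d \<bullet> (u - p)) - ereal \<nu>"
    using d by (auto simp: eps_subdiff_def)
  then show ?thesis
    using ereal_real_on_edom[OF proper] u by (simp add: inner_diff_right)
qed

text \<open>
  The basic inequality of an iBPPA step from the centre \<open>a\<close> to the new centre \<open>b\<close> with approximate
  minimiser \<open>p\<close>, tested at an arbitrary \<open>u\<close>.
\<close>
lemma inexact_bregman_step:
  assumes proper: "\<forall>x. f x \<noteq> -\<infinity>" and bdd: "bdd_above (pair_dists f C)"
    and B: "bregman_function g C" and a: "a \<in> C" and \<gamma>: "\<gamma> > 0"
    and u: "u \<in> edom f \<inter> closure C" and p: "p \<in> edom f \<inter> closure C"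
    and d: "d \<in> eps_subdiff \<nu> f p"
    and \<Delta>: "norm (d + \<gamma> *\<^sub>R (grad g b - grad g a)) \<le> \<eta>"
    and \<mu>: "bregman_dist g p b \<le> \<mu>"
  shows "fin f p \<le> fin f u + (dom_diam f C * \<eta> + \<nu>)
           + \<gamma> * (bregman_dist g u a - bregman_dist g u b + \<mu>)"
proof -
  define \<Delta> where "\<Delta> = d + \<gamma> *\<^sub>R (grad g b - grad g a)"
  have "\<Delta> \<bullet> (p - u) \<le> norm \<Delta> * norm (p - u)" by (rule norm_cauchy_schwarz)
  also have "\<dots> \<le> \<eta> * dom_diam f C"
    using \<Delta> norm_diff_le_dom_diam[OF bdd p u] order_trans[OF norm_ge_zero \<Delta>]
    by (intro mult_mono) (auto simp: \<Delta>_def)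
  finally have residual: "\<Delta> \<bullet> (p - u) \<le> \<eta> * dom_diam f C" .
  have "d \<bullet> (p - u) = \<Delta> \<bullet> (p - u) + \<gamma> * ((grad g b - grad g a) \<bullet> (u - p))"
    by (simp add: \<Delta>_def inner_add_left inner_diff_left inner_diff_right algebra_simps)
  also have "\<dots> \<le> \<eta> * dom_diam f C
      + \<gamma> * (bregman_dist g u a - bregman_dist g u b + \<mu>)"
    unfolding bregman_dist_four_point
    using residual \<mu> \<gamma> bregman_dist_nonneg[OF B a, of p] p
    by (intro add_mono mult_left_mono) auto
  finally show ?thesis
    using eps_subdiff_fin[OF proper d, of u] u by (simp add: mult.commute)
qed

section \<open>Summation\<close>

lemma inv_step_sum_eq: "N \<ge> 1 \<Longrightarrow> inv_step_sum \<gamma> (N - 1) = (\<Sum>k<N. inverse (\<gamma> k))"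
  by (cases N) (simp_all add: inv_step_sum_def lessThan_Suc_atMost)

lemma prev_inv_step_sum: "prev (inv_step_sum \<gamma>) k = (\<Sum>i<k. inverse (\<gamma> i))"
  using inv_step_sum_eq[of k \<gamma>] by (cases k) (simp_all add: prev_def)

text \<open>
  Summation by parts.  For \<open>w\<close> nonnegative and \<open>a\<close> decreasing the second sum is nonpositive, so that
  the last value is at most the weighted mean of \<open>a 1, \<dots>, a N\<close>.  The value \<open>a 0\<close> occurs only with
  the weight \<open>0\<close> of an empty sum, so it may be arbitrary.
\<close>
lemma last_value_by_parts:
  fixes a w :: "nat \<Rightarrow> real"
  shows "(\<Sum>k<N. w k) * (a N - c) =
    (\<Sum>k<N. w k * (a (Suc k) - c)) + (\<Sum>k<N. (\<Sum>i<k. w i) * (a (Suc k) - a k))"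
  by (induction N) (simp_all add: algebra_simps)

text \<open>
  Dividing the step inequality by \<open>\<gamma> k\<close> makes the distances \<open>D k\<close> telescope; the last one is
  nonnegative and is dropped.
\<close>
lemma weighted_gap_sum_le:
  fixes a D :: "nat \<Rightarrow> real"
  assumes \<gamma>: "\<And>k. \<gamma> k > 0"
    and step: "\<And>k. a (Suc k) \<le> c + \<epsilon> k + \<gamma> k * (D k - D (Suc k) + \<mu> k)"
    and D: "0 \<le> D N"
  shows "(\<Sum>k<N. inverse (\<gamma> k) * (a (Suc k) - c)) \<le>
           D 0 + (\<Sum>k<N. \<mu> k) + (\<Sum>k<N. inverse (\<gamma> k) * \<epsilon> k)"
proof -
  have "inverse (\<gamma> k) * (a (Suc k) - c) \<le> (D k - D (Suc k)) + \<mu> k + inverse (\<gamma> k) * \<epsilon> k" for k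
  proof -
    have "inverse (\<gamma> k) * (a (Suc k) - c)
        \<le> inverse (\<gamma> k) * (\<epsilon> k + \<gamma> k * (D k - D (Suc k) + \<mu> k))"
      using step[of k] \<gamma>[of k] by (intro mult_left_mono) auto
    also have "\<dots> = (D k - D (Suc k)) + \<mu> k + inverse (\<gamma> k) * \<epsilon> k"
      using \<gamma>[of k] by (simp add: distrib_left flip: mult.assoc)
    finally show ?thesis .
  qed
  then have "(\<Sum>k<N. inverse (\<gamma> k) * (a (Suc k) - c)) \<le>
      (\<Sum>k<N. (D k - D (Suc k)) + \<mu> k + inverse (\<gamma> k) * \<epsilon> k)"
    by (intro sum_mono)
  also have "\<dots> = (D 0 - D N) + (\<Sum>k<N. \<mu> k) + (\<Sum>k<N. inverse (\<gamma> k) * \<epsilon> k)"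
    by (simp only: sum.distrib sum_lessThan_telescope')
  finally show ?thesis using D by simp
qed

section \<open>The convergence rate\<close>

theorem theorem3p1:
  fixes f \<phi> :: "'a::euclidean_space \<Rightarrow> ereal"
    and C :: "'a set"
    and \<gamma> \<eta> \<mu> \<nu> :: "nat \<Rightarrow> real"
    and x xt :: "nat \<Rightarrow> 'a"
  assumes "proper_closed_convex f"
    and "C \<noteq> {}" and "convex C" and "open C"
    and "assumption_A f \<phi> C"
    and "\<And>k. \<gamma> k > 0"
    and "\<And>k. \<eta> k \<ge> 0" and "\<And>k. \<mu> k \<ge> 0" and "\<And>k. \<nu> k \<ge> 0"
    and "iBPPA f \<phi> C \<gamma> \<eta> \<mu> \<nu> x xt"
  shows "(\<forall>k. xi f xt k \<le> ereal (\<gamma> k * (prev \<mu> k + \<mu> k) + dom_diam f C * \<eta> k + \<nu> k))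
    \<and> (\<forall>xs. optimal_solution f C xs \<longrightarrow>
         (\<forall>N\<ge>1. f (xt N) - f xs \<le>
            ereal (inverse (inv_step_sum \<gamma> (N - 1))) *
              (ereal (bregman_dist (fin \<phi>) xs (x 0) + (\<Sum>k<N. \<mu> k)
                      + (\<Sum>k<N. inverse (\<gamma> k) * (dom_diam f C * \<eta> k + \<nu> k)))
               + (\<Sum>k<N. ereal (prev (inv_step_sum \<gamma>) k) * xi f xt k))))
    \<and> (\<forall>xs. optimal_solution f C xs \<longrightarrow>
         summable \<mu> \<longrightarrow>
         summable (\<lambda>k. inverse (\<gamma> k) * \<nu> k) \<longrightarrow>
         summable (\<lambda>k. inverse (\<gamma> k) * \<eta> k) \<longrightarrow>
         (\<exists>B::real. \<forall>N. (\<Sum>k<N. ereal (prev (inv_step_sum \<gamma>) k) * xi f xt k) \<le> ereal B) \<longrightarrow>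
         (\<exists>M::real. \<forall>N\<ge>1. f (xt N) - f xs \<le> ereal (M * inverse (\<Sum>k<N. inverse (\<gamma> k)))))"
proof -
  let ?D = "bregman_dist (fin \<phi>)" and ?\<rho> = "dom_diam f C"
  note \<gamma> = assms(6) and \<eta> = assms(7) and \<mu> = assms(8) and \<nu> = assms(9)
  define a where "a k = fin f (xt k)" for k
  define \<epsilon> where "\<epsilon> k = ?\<rho> * \<eta> k + \<nu> k" for k
  define gap where "gap N = (\<Sum>k<N. (\<Sum>i<k. inverse (\<gamma> i)) * (a (Suc k) - a k))" for N
  have proper: "\<forall>x. f x \<noteq> -\<infinity>"
    using assms(1) by (simp add: proper_closed_convex_def)
  have dom: "edom f \<inter> C \<noteq> {}" and bdd: "bdd_above (pair_dists f C)"
    and B: "bregman_function (fin \<phi>) C"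
    using assms(5) by (auto simp: assumption_A_def)
  have x0: "x 0 = xt 0" and xC: "x k \<in> C" and xtdom: "xt (Suc k) \<in> edom f \<inter> closure C"
    and xtD: "?D (xt (Suc k)) (x (Suc k)) \<le> \<mu> k" for k
    using assms(10) by (cases k; auto simp: iBPPA_def)+
  have xtcl: "xt k \<in> closure C" for k
    using xC[of 0] x0 xtdom closure_subset by (cases k) auto
  have step: "a (Suc k) \<le> fin f u + \<epsilon> k + \<gamma> k * (?D u (x k) - ?D u (x (Suc k)) + \<mu> k)"
    if u: "u \<in> edom f \<inter> closure C" for u k
  proof -
    obtain d where "d \<in> eps_subdiff (\<nu> k) f (xt (Suc k))"
      and "norm (d + \<gamma> k *\<^sub>R (grad (fin \<phi>) (x (Suc k)) - grad (fin \<phi>) (x k))) \<le> \<eta> k"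
      using assms(10) unfolding iBPPA_def by blast
    then show ?thesis
      unfolding a_def \<epsilon>_def
      using inexact_bregman_step[OF proper bdd B xC \<gamma> u xtdom _ _ xtD] by blast
  qed

  have xi_le: "xi f xt k \<le> ereal (\<gamma> k * (prev \<mu> k + \<mu> k) + ?\<rho> * \<eta> k + \<nu> k)" for k
  proof (cases "xt k \<in> edom f")
    case True
    have "?D (xt k) (x k) \<le> prev \<mu> k"
      using x0 xtD by (cases k) (simp_all add: prev_def bregman_dist_def)
    moreover have "0 \<le> ?D (xt k) (x (Suc k))"
      by (rule bregman_dist_nonneg[OF B xC xtcl])
    ultimately have "\<gamma> k * (?D (xt k) (x k) - ?D (xt k) (x (Suc k)) + \<mu> k)
        \<le> \<gamma> k * (prev \<mu> k + \<mu> k)"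
      using \<gamma>[of k] by (intro mult_left_mono) auto
    then have "a (Suc k) - a k \<le> \<gamma> k * (prev \<mu> k + \<mu> k) + ?\<rho> * \<eta> k + \<nu> k"
      using step[of "xt k" k] True xtcl by (simp add: a_def \<epsilon>_def)
    moreover have "xi f xt k = ereal (a (Suc k) - a k)"
      using ereal_real_on_edom[OF proper] True xtdom by (simp add: xi_def a_def)
    ultimately show ?thesis by simp
  next
    \<comment> \<open>Only the starting point can have the value infinity, and then the gap is minus infinity.\<close>
    case False
    then have "f (xt k) = \<infinity>" by (simp add: edom_def)
    moreover have "f (xt (Suc k)) = ereal (a (Suc k))"
      using ereal_real_on_edom[OF proper] xtdom by (simp add: a_def)
    ultimately show ?thesis by (simp add: xi_def)
  qed

  have term_eq: "ereal (prev (inv_step_sum \<gamma>) k) * xi f xt k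
      = ereal ((\<Sum>i<k. inverse (\<gamma> i)) * (a (Suc k) - a k))" for k
  proof (cases k)
    case 0
    \<comment> \<open>The zero weight absorbs a possibly infinite gap.\<close>
    then show ?thesis by (simp add: prev_inv_step_sum flip: zero_ereal_def)
  next
    case (Suc j)
    have "xi f xt k = ereal (a (Suc k) - a k)"
      using ereal_real_on_edom[OF proper] xtdom Suc by (simp add: xi_def a_def)
    then show ?thesis by (simp add: prev_inv_step_sum)
  qed
  have gap_eq: "(\<Sum>k<N. ereal (prev (inv_step_sum \<gamma>) k) * xi f xt k) = ereal (gap N)" for N
    by (simp add: term_eq gap_def)

  have main: "f (xt N) - f xs = ereal (a N - fin f xs)"
    "a N - fin f xs \<le> inverse (\<Sum>k<N. inverse (\<gamma> k)) *
       (?D xs (x 0) + (\<Sum>k<N. \<mu> k) + (\<Sum>k<N. inverse (\<gamma> k) * \<epsilon> k) + gap N)"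
    if opt: "optimal_solution f C xs" and N: "N \<ge> 1" for xs N
  proof -
    have xs: "xs \<in> edom f \<inter> closure C"
    proof -
      obtain y where "y \<in> edom f" "y \<in> C" using dom by blast
      then have "f xs \<le> f y" "f y < \<infinity>"
        using opt closure_subset by (auto simp: optimal_solution_def edom_def)
      then show ?thesis using opt by (auto simp: optimal_solution_def edom_def)
    qed
    have "xt N \<in> edom f" using xtdom[of "N - 1"] N by simp
    then show "f (xt N) - f xs = ereal (a N - fin f xs)"
      using ereal_real_on_edom[OF proper] xs by (simp add: a_def)
    have pos: "0 < (\<Sum>k<N. inverse (\<gamma> k))"
      using N \<gamma> by (intro sum_pos) (auto simp: lessThan_empty_iff)
    have "(\<Sum>k<N. inverse (\<gamma> k) * (a (Suc k) - fin f xs)) \<le>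
        ?D xs (x 0) + (\<Sum>k<N. \<mu> k) + (\<Sum>k<N. inverse (\<gamma> k) * \<epsilon> k)"
      using step[OF xs] xs bregman_dist_nonneg[OF B xC, of xs]
      by (intro weighted_gap_sum_le[where D = "\<lambda>k. ?D xs (x k)"] \<gamma>) auto
    then have "(\<Sum>k<N. inverse (\<gamma> k)) * (a N - fin f xs) \<le>
        ?D xs (x 0) + (\<Sum>k<N. \<mu> k) + (\<Sum>k<N. inverse (\<gamma> k) * \<epsilon> k) + gap N"
      unfolding last_value_by_parts gap_def by simp
    with pos show "a N - fin f xs \<le> inverse (\<Sum>k<N. inverse (\<gamma> k)) *
       (?D xs (x 0) + (\<Sum>k<N. \<mu> k) + (\<Sum>k<N. inverse (\<gamma> k) * \<epsilon> k) + gap N)"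
      by (simp add: pos_le_divide_eq mult.commute inverse_eq_divide)
  qed

  have bound: "f (xt N) - f xs \<le> ereal (inverse (inv_step_sum \<gamma> (N - 1))) *
      (ereal (?D xs (x 0) + (\<Sum>k<N. \<mu> k) + (\<Sum>k<N. inverse (\<gamma> k) * (?\<rho> * \<eta> k + \<nu> k)))
       + (\<Sum>k<N. ereal (prev (inv_step_sum \<gamma>) k) * xi f xt k))"
    if "optimal_solution f C xs" "N \<ge> 1" for xs N
    using main[OF that] by (simp add: gap_eq inv_step_sum_eq[OF that(2)] \<epsilon>_def del: One_nat_def)

  have rate: "\<exists>M::real. \<forall>N\<ge>1. f (xt N) - f xs \<le> ereal (M * inverse (\<Sum>k<N. inverse (\<gamma> k)))"
    if opt: "optimal_solution f C xs" and s\<mu>: "summable \<mu>"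
      and s\<nu>: "summable (\<lambda>k. inverse (\<gamma> k) * \<nu> k)" and s\<eta>: "summable (\<lambda>k. inverse (\<gamma> k) * \<eta> k)"
      and gapB: "\<And>N. (\<Sum>k<N. ereal (prev (inv_step_sum \<gamma>) k) * xi f xt k) \<le> ereal b" for xs b
  proof (intro exI allI impI)
    let ?M = "?D xs (x 0) + (\<Sum>k. \<mu> k) + (\<Sum>k. inverse (\<gamma> k) * \<epsilon> k) + b"
    fix N :: nat assume N: "N \<ge> 1"
    have "0 \<le> ?\<rho>"
      using dom closure_subset by (intro dom_diam_nonneg[OF bdd]) blast
    then have \<epsilon>: "0 \<le> \<epsilon> k" for k using \<eta> \<nu> by (simp add: \<epsilon>_def)
    have "summable (\<lambda>k. ?\<rho> * (inverse (\<gamma> k) * \<eta> k) + inverse (\<gamma> k) * \<nu> k)"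
      using s\<eta> s\<nu> by (intro summable_add summable_mult)
    then have s\<epsilon>: "summable (\<lambda>k. inverse (\<gamma> k) * \<epsilon> k)"
      by (simp add: \<epsilon>_def algebra_simps)
    have "(\<Sum>k<N. \<mu> k) \<le> (\<Sum>k. \<mu> k)"
      using s\<mu> \<mu> by (intro sum_le_suminf) auto
    moreover have "(\<Sum>k<N. inverse (\<gamma> k) * \<epsilon> k) \<le> (\<Sum>k. inverse (\<gamma> k) * \<epsilon> k)"
      using s\<epsilon> \<epsilon> \<gamma> by (intro sum_le_suminf) (auto simp: less_imp_le)
    moreover have "gap N \<le> b" using gapB[of N] by (simp add: gap_eq)
    ultimately have "inverse (\<Sum>k<N. inverse (\<gamma> k)) *
        (?D xs (x 0) + (\<Sum>k<N. \<mu> k) + (\<Sum>k<N. inverse (\<gamma> k) * \<epsilon> k) + gap N)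
        \<le> inverse (\<Sum>k<N. inverse (\<gamma> k)) * ?M"
      using \<gamma> by (intro mult_left_mono) (auto simp: sum_nonneg less_imp_le)
    with main[OF opt N] show "f (xt N) - f xs \<le> ereal (?M * inverse (\<Sum>k<N. inverse (\<gamma> k)))"
      by (simp add: mult.commute)
  qed
  show ?thesis
    using xi_le bound rate by blast
qed

end
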